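(* Let $n\ge 1$ and $20n\le m<2^{n/2}$ be integers. Any $\mathsf{PostBPP}$ communication protocol that solves $\textsc{XOR-Missing-String}(n,m)$ with error at most $2^{-5n}$ has communication complexity $\Omega(m)$. That is, there is an absolute constant $c>0$ such that its complexity is at least $cm$.
   Context: $\textsc{XOR-Missing-String}(n,m)$, for $m<2^{n/2}$, is the following problem. Alice receives $X=(x_1,\dots,x_m)$ and Bob receives $Y=(y_1,\dots,y_m)$, with all $x_i,y_j\in\{0,1\}^n$. A string $s\in\{0,1\}^n$ is a solution on input $(X,Y)$ if $s\ne x_i\oplus y_j$ for all $i,j\in[m]$, where $\oplus$ is bitwise XOR. A $\mathsf{PostBPP}$ communication protocol $\Pi$ for a search problem $f$ on $\mathcal{X}\times\mathcal{Y}$ with range $\mathcal{O}$ is given by a length $k$ and a family $\{\Pi_r\}_{r\in\{0,1\}^k}$ of deterministic communication protocols, each of communication complexity $c$. Each $\Pi_r$ outputs either $\bot$ or an element of $\mathcal{O}$. On input $(X,Y)$, the protocol draws a uniform public random $r$ and runs $\Pi_r$. Its complexity is $k+c$. The protocol solves $f$ with error $\epsilon$ if for every input $(X,Y)$, \[ \Pr_r\big[\Pi_r(X,Y)\text{ is a solution to }f(X,Y)\,\big|\,\Pi_r(X,Y)\ne\bot\big]\ge 1-\epsilon. \] *)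

theory Defs
  imports "HOL-Probability.Probability_Mass_Function"
begin

section \<open>Deterministic communication protocols\<close>

text \<open>
  A deterministic two-party protocol is a binary tree. At an inner node one player sends the bit
  obtained by applying the given predicate to his or her own input; the run continues in the first
  subtree if that bit is 1 and in the second one otherwise. Leaves carry the output.
\<close>

datatype (dead 'x, dead 'y, outputs: 'o) protocol =
    Output 'o
  | Alice "'x \<Rightarrow> bool" "('x, 'y, 'o) protocol" "('x, 'y, 'o) protocol"
  | Bob "'y \<Rightarrow> bool" "('x, 'y, 'o) protocol" "('x, 'y, 'o) protocol"

primrec run :: "('x, 'y, 'o) protocol \<Rightarrow> 'x \<Rightarrow> 'y \<Rightarrow> 'o" where
  "run (Output out) x y = out"
| "run (Alice a p q) x y = (if a x then run p x y else run q x y)"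
| "run (Bob b p q) x y = (if b y then run p x y else run q x y)"

primrec comm_complexity :: "('x, 'y, 'o) protocol \<Rightarrow> nat" where
  "comm_complexity (Output out) = 0"
| "comm_complexity (Alice a p q) = 1 + max (comm_complexity p) (comm_complexity q)"
| "comm_complexity (Bob b p q) = 1 + max (comm_complexity p) (comm_complexity q)"


section \<open>Search problems and PostBPP protocols\<close>

record ('x, 'y, 'o) search_problem =
  alice_inputs :: "'x set"
  bob_inputs :: "'y set"
  range_of :: "'o set"
  is_solution :: "'x \<Rightarrow> 'y \<Rightarrow> 'o \<Rightarrow> bool"

definition bitstrings :: "nat \<Rightarrow> bool list set" where
  "bitstrings n = {s. length s = n}"

lemma finite_bitstrings: "finite (bitstrings n)"
  using finite_lists_length_eq[of "UNIV :: bool set" n] by (simp add: bitstrings_def)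

lemma bitstrings_nonempty: "bitstrings n \<noteq> {}"
  using length_replicate[of n False] unfolding bitstrings_def by blast

text \<open>
  The output \<open>None\<close> plays the role of \<open>\<bottom>\<close>. Only the values of \<open>family\<close> on bit strings of
  length \<open>rand_length\<close> matter.
\<close>

record ('x, 'y, 'o) postBPP_protocol =
  rand_length :: nat
  family :: "bool list \<Rightarrow> ('x, 'y, 'o option) protocol"

text \<open>
  The members of the family need not all have the same communication complexity; \<open>c\<close> is the
  largest one.
\<close>

definition postBPP_complexity :: "('x, 'y, 'o) postBPP_protocol \<Rightarrow> nat" where
  "postBPP_complexity P =
     rand_length P + Max ((\<lambda>r. comm_complexity (family P r)) ` bitstrings (rand_length P))"

definition postBPP_protocol_for ::
    "('x, 'y, 'o) search_problem \<Rightarrow> ('x, 'y, 'o) postBPP_protocol \<Rightarrow> bool" where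
  "postBPP_protocol_for f P \<longleftrightarrow>
     (\<forall>r \<in> bitstrings (rand_length P). outputs (family P r) \<subseteq> insert None (Some ` range_of f))"

abbreviation public_coins :: "('x, 'y, 'o) postBPP_protocol \<Rightarrow> bool list measure" where
  "public_coins P \<equiv> measure_pmf (pmf_of_set (bitstrings (rand_length P)))"

text \<open>
  The first conjunct about probabilities says that the conditional probability is defined,
  i.e. that the protocol does not output \<open>\<bottom>\<close> with probability 1 on any input.
\<close>

definition solves_with_error ::
    "('x, 'y, 'o) postBPP_protocol \<Rightarrow> ('x, 'y, 'o) search_problem \<Rightarrow> real \<Rightarrow> bool" where
  "solves_with_error P f \<epsilon> \<longleftrightarrow>
     postBPP_protocol_for f P \<and>
     (\<forall>X \<in> alice_inputs f. \<forall>Y \<in> bob_inputs f.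
        \<P>(r in public_coins P. run (family P r) X Y \<noteq> None) > 0 \<and>
        \<P>(r in public_coins P.
             (\<exists>s. run (family P r) X Y = Some s \<and> s \<in> range_of f \<and> is_solution f X Y s)
           \<bar> run (family P r) X Y \<noteq> None) \<ge> 1 - \<epsilon>)"


section \<open>The problem XOR-Missing-String\<close>

definition xor_string :: "bool list \<Rightarrow> bool list \<Rightarrow> bool list" (infixl "\<oplus>" 65) where
  "x \<oplus> y = map2 (\<noteq>) x y"

text \<open>
  An input of either player is a list of \<open>m\<close> (not necessarily distinct) strings of length \<open>n\<close>.
\<close>

definition XOR_Missing_String ::
    "nat \<Rightarrow> nat \<Rightarrow> (bool list list, bool list list, bool list) search_problem" where
  "XOR_Missing_String n m =
     \<lparr> alice_inputs = {X. length X = m \<and> set X \<subseteq> bitstrings n},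
       bob_inputs = {Y. length Y = m \<and> set Y \<subseteq> bitstrings n},
       range_of = bitstrings n,
       is_solution = (\<lambda>X Y s. \<forall>i<m. \<forall>j<m. s \<noteq> X ! i \<oplus> Y ! j) \<rparr>"

end

theory Submission
  imports Defs
begin

text \<open>
  Let \<open>N = 2 ^ n\<close>. On a rectangle \<open>A \<times> B\<close> of density above \<open>2 ^ (1 - m)\<close>,
  any fixed answer \<open>s\<close> is wrong with probability at least \<open>N ^ -4\<close>. Indeed, either some \<open>z\<close> occurs
  in \<open>X \<in> A\<close> and \<open>s \<oplus> z\<close> occurs in \<open>Y \<in> B\<close>, each with probability at least \<open>N ^ -2\<close>, or on one
  side at least half of all strings are rare; by a union bound at least half of that side consists
  of tuples avoiding all rare strings, and there are at most \<open>(N / 2) ^ m\<close> of these.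
  If the complexity \<open>k + c\<close> is at most \<open>m - 2\<close>, the rectangles of smaller density carry at
  most half of the mass of the answers other than \<open>\<bottom>\<close>, because every input gets such an answer with
  probability at least \<open>2 ^ -k\<close>. So the error is at least \<open>N ^ -4 / 2 > N ^ -5\<close>.
\<close>

section \<open>Frequent entries in large sets of tuples\<close>

text \<open>By the union bound, the tuples of \<open>A\<close> that meet \<open>S\<close> make up at
  most a fraction \<open>1 / card V\<close>, hence at most half, of \<open>A\<close>. The others are
  words over \<open>V - S\<close>, an alphabet of at most half the size.\<close>

lemma card_le_if_rare_elements:
  fixes A :: "'a list set"
  assumes V: "finite V" "card V \<ge> 2" and A: "A \<subseteq> {xs. set xs \<subseteq> V \<and> length xs = m}"
    and S: "S \<subseteq> V" "card V \<le> 2 * card S"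
    and rare: "\<And>z. z \<in> S \<Longrightarrow> real (card {xs \<in> A. z \<in> set xs}) \<le> card A / card V ^ 2"
  shows "real (card A) \<le> 2 * (card V / 2) ^ m"
proof -
  have fin: "finite A" "finite S"
    using finite_subset[OF A finite_lists_length_eq[OF V(1)]] finite_subset[OF S(1) V(1)] by auto
  let ?L = "{xs. set xs \<subseteq> V - S \<and> length xs = m}"
  have "A \<subseteq> (\<Union>z\<in>S. {xs \<in> A. z \<in> set xs}) \<union> ?L"
    using A by auto
  then have "card A \<le> card ((\<Union>z\<in>S. {xs \<in> A. z \<in> set xs}) \<union> ?L)"
    using fin finite_lists_length_eq[of "V - S" m] V by (intro card_mono) auto
  also have "\<dots> \<le> card (\<Union>z\<in>S. {xs \<in> A. z \<in> set xs}) + card ?L"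
    by (rule card_Un_le)
  also have "\<dots> \<le> (\<Sum>z\<in>S. card {xs \<in> A. z \<in> set xs}) + (card V - card S) ^ m"
    using card_UN_le[OF fin(2), of "\<lambda>z. {xs \<in> A. z \<in> set xs}"] V S fin
    by (simp add: card_lists_length_eq card_Diff_subset)
  finally have "real (card A) \<le> real ((\<Sum>z\<in>S. card {xs \<in> A. z \<in> set xs}) + (card V - card S) ^ m)"
    by (rule of_nat_mono)
  also have "\<dots> = (\<Sum>z\<in>S. real (card {xs \<in> A. z \<in> set xs})) + real (card V - card S) ^ m"
    unfolding of_nat_add of_nat_sum of_nat_power ..
  also have "\<dots> \<le> (\<Sum>z\<in>S. card A / card V ^ 2) + (card V / 2) ^ m"
    using S rare by (intro add_mono sum_mono power_mono) auto
  also have "(\<Sum>z\<in>S. card A / card V ^ 2) \<le> card V * (card A / card V ^ 2)"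
    using card_mono[OF V(1) S(1)] by (simp add: divide_right_mono mult_right_mono)
  also have "\<dots> = card A / card V"
    using V by (simp add: power2_eq_square)
  also have "\<dots> \<le> card A / 2"
    using V by (intro divide_left_mono) auto
  finally show ?thesis by simp
qed

lemma collision_frequent:
  fixes A B :: "'a list set"
  assumes V: "finite V" "card V \<ge> 2" and f: "inj_on f V" "f ` V \<subseteq> V"
    and A: "A \<subseteq> {xs. set xs \<subseteq> V \<and> length xs = m}" "2 * (card V / 2) ^ m < real (card A)"
    and B: "B \<subseteq> {xs. set xs \<subseteq> V \<and> length xs = m}" "2 * (card V / 2) ^ m < real (card B)"
  shows "real (card A) * real (card B) / card V ^ 4
    \<le> card {(xs, ys) \<in> A \<times> B. \<exists>z\<in>set xs. f z \<in> set ys}"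
proof -
  let ?a = "\<lambda>z. {xs \<in> A. z \<in> set xs}" and ?b = "\<lambda>z. {ys \<in> B. z \<in> set ys}"
  define S where "S = {z \<in> V. real (card (?a z)) \<le> card A / card V ^ 2}"
  have S: "S \<subseteq> V" by (auto simp: S_def)
  \<comment> \<open>Fewer than half of all elements are rare in \<open>A\<close>. By injectivity,
    \<open>f\<close> sends the remaining ones onto at least half of \<open>V\<close>, which is too
    many for all the images to be rare in \<open>B\<close>.\<close>
  have "\<not> card V \<le> 2 * card S"
    using card_le_if_rare_elements[OF V A(1) S] A(2) by (auto simp: S_def)
  moreover have "card (f ` (V - S)) = card V - card S"
    using card_image[OF inj_on_subset[OF f(1)], of "V - S"] S V
    by (simp add: card_Diff_subset finite_subset)
  ultimately have "card V \<le> 2 * card (f ` (V - S))" by simp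
  moreover have "f ` (V - S) \<subseteq> V" using f by auto
  ultimately have "\<not> (\<forall>w\<in>f ` (V - S). real (card (?b w)) \<le> card B / card V ^ 2)"
    using card_le_if_rare_elements[OF V B(1), of "f ` (V - S)"] B(2) by auto
  then obtain z where z: "z \<in> V - S" "card B / card V ^ 2 \<le> real (card (?b (f z)))"
    by (auto simp: not_le intro: less_imp_le)
  have fin: "finite A" "finite B"
    using finite_subset[OF A(1) finite_lists_length_eq[OF V(1)]]
      finite_subset[OF B(1) finite_lists_length_eq[OF V(1)]] by auto
  have "real (card A) * real (card B) / card V ^ 4
      = (card A / card V ^ 2) * (card B / card V ^ 2)"
    by (simp flip: power_add)
  also have "\<dots> \<le> card (?a z) * card (?b (f z))"
    unfolding of_nat_mult using z by (intro mult_mono) (auto simp: S_def)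
  also have "\<dots> = card (?a z \<times> ?b (f z))"
    by (simp add: card_cartesian_product)
  also have "\<dots> \<le> card {(xs, ys) \<in> A \<times> B. \<exists>z\<in>set xs. f z \<in> set ys}"
    unfolding of_nat_le_iff
    by (rule card_mono[OF finite_subset[of _ "A \<times> B"]]) (use fin in auto)
  finally show ?thesis .
qed

section \<open>Bitwise XOR and counting of bit strings\<close>

lemma xor_string_cancel: "length x = length y \<Longrightarrow> x \<oplus> (x \<oplus> y) = y"
  by (rule nth_equalityI) (auto simp: xor_string_def)

lemma xor_string_commute: "x \<oplus> y = y \<oplus> x"
  by (rule nth_equalityI) (auto simp: xor_string_def)

lemma length_xor_string [simp]: "length (x \<oplus> y) = min (length x) (length y)"
  by (simp add: xor_string_def)

lemma card_bitstrings: "card (bitstrings n) = 2 ^ n"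
  using card_lists_length_eq[of "UNIV :: bool set" n] by (simp add: bitstrings_def)

section \<open>Errors of a deterministic protocol, leaf by leaf\<close>

text \<open>Lets the losses written off in two subtrees fit into the allowance of their parent,
  whose depth is one more than the maximum.\<close>

lemma two_power_add_le: "(2::real) ^ a + 2 ^ b \<le> 2 * 2 ^ max a b"
proof -
  have "(2::real) ^ a + 2 ^ b \<le> 2 ^ max a b + 2 ^ max a b"
    by (intro add_mono power_increasing) auto
  then show ?thesis by simp
qed

text \<open>
  Leaves whose rectangle has at most \<open>t\<close> elements are written off in the term \<open>2 ^ comm_complexity p * t\<close>.
\<close>

lemma protocol_error_ge:
  fixes p :: "('x, 'y, 'o option) protocol" and \<eta> t :: real
  assumes "finite A" "finite B" "0 \<le> \<eta>" "0 \<le> t" "outputs p \<subseteq> insert None (Some ` Z)"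
    and "\<And>s A' B'. s \<in> Z \<Longrightarrow> A' \<subseteq> A \<Longrightarrow> B' \<subseteq> B \<Longrightarrow> t < real (card A') * real (card B') \<Longrightarrow>
      \<eta> * (card A' * card B') \<le> (\<Sum>x\<in>A'. \<Sum>y\<in>B'. of_bool (W s x y))"
  shows "\<eta> * ((\<Sum>x\<in>A. \<Sum>y\<in>B. of_bool (run p x y \<noteq> None)) - 2 ^ comm_complexity p * t)
    \<le> (\<Sum>x\<in>A. \<Sum>y\<in>B. of_bool (\<exists>s. run p x y = Some s \<and> W s x y))"
  using assms
proof (induction p arbitrary: A B)
  case (Output out)
  show ?case
  proof (cases out)
    case None
    then show ?thesis using Output by simp
  next
    case (Some s)
    then have "s \<in> Z" using Output by auto
    show ?thesis
    proof (cases "t < real (card A) * real (card B)")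
      case True
      have "\<eta> * (real (card A) * real (card B) - t) \<le> \<eta> * (real (card A) * real (card B))"
        using Output.prems by (intro mult_left_mono) auto
      with Output.prems(6)[OF \<open>s \<in> Z\<close> order_refl order_refl True] show ?thesis
        using Some by simp
    next
      \<comment> \<open>A leaf has complexity 0, so the whole allowance is \<open>t\<close>, and it
        covers the small rectangle entirely.\<close>
      case False
      then have "\<eta> * (real (card A) * real (card B) - t) \<le> 0"
        using Output.prems by (intro mult_nonneg_nonpos) auto
      also have "0 \<le> (\<Sum>x\<in>A. \<Sum>y\<in>B. of_bool (W s x y) :: real)"
        by (intro sum_nonneg) auto
      finally show ?thesis using Some by simp
    qed
  qed
next
  case (Alice a p q)
  let ?n = "\<lambda>p A. \<Sum>x\<in>A. \<Sum>y\<in>B. of_bool (run p x y \<noteq> None) :: real"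
  let ?e = "\<lambda>p A. \<Sum>x\<in>A. \<Sum>y\<in>B. of_bool (\<exists>s. run p x y = Some s \<and> W s x y) :: real"
  \<comment> \<open>Alice's bit cuts the rectangle along her side only. The error hypothesis speaks
    of all subrectangles, so both halves inherit it.\<close>
  have p: "\<eta> * (?n p (A \<inter> Collect a) - 2 ^ comm_complexity p * t) \<le> ?e p (A \<inter> Collect a)"
    using Alice.prems(1-5) by (intro Alice.IH Alice.prems(6)) auto
  have q: "\<eta> * (?n q (A - Collect a) - 2 ^ comm_complexity q * t) \<le> ?e q (A - Collect a)"
    using Alice.prems(1-5) by (intro Alice.IH Alice.prems(6)) auto
  have n: "?n (Alice a p q) A = ?n p (A \<inter> Collect a) + ?n q (A - Collect a)"
    by (subst sum.Int_Diff[OF \<open>finite A\<close>, of _ "Collect a"])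
      (intro arg_cong2[where f="(+)"] sum.cong, auto)
  have e: "?e (Alice a p q) A = ?e p (A \<inter> Collect a) + ?e q (A - Collect a)"
    by (subst sum.Int_Diff[OF \<open>finite A\<close>, of _ "Collect a"])
      (intro arg_cong2[where f="(+)"] sum.cong, auto)
  have "(2::real) ^ comm_complexity p + 2 ^ comm_complexity q \<le> 2 ^ comm_complexity (Alice a p q)"
    using two_power_add_le by simp
  then have "\<eta> * (?n (Alice a p q) A - 2 ^ comm_complexity (Alice a p q) * t)
      \<le> \<eta> * (?n (Alice a p q) A - (2 ^ comm_complexity p + 2 ^ comm_complexity q) * t)"
    using Alice.prems by (intro mult_left_mono diff_left_mono mult_right_mono) auto
  then show ?case using p q unfolding n e by (simp add: algebra_simps)
next
  case (Bob b p q)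
  let ?n = "\<lambda>p B. \<Sum>x\<in>A. \<Sum>y\<in>B. of_bool (run p x y \<noteq> None) :: real"
  let ?e = "\<lambda>p B. \<Sum>x\<in>A. \<Sum>y\<in>B. of_bool (\<exists>s. run p x y = Some s \<and> W s x y) :: real"
  have p: "\<eta> * (?n p (B \<inter> Collect b) - 2 ^ comm_complexity p * t) \<le> ?e p (B \<inter> Collect b)"
    using Bob.prems(1-5) by (intro Bob.IH Bob.prems(6)) auto
  have q: "\<eta> * (?n q (B - Collect b) - 2 ^ comm_complexity q * t) \<le> ?e q (B - Collect b)"
    using Bob.prems(1-5) by (intro Bob.IH Bob.prems(6)) auto
  have n: "?n (Bob b p q) B = ?n p (B \<inter> Collect b) + ?n q (B - Collect b)"
    unfolding sum.distrib[symmetric] sum.Int_Diff[OF \<open>finite B\<close>, of _ "Collect b"]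
    by (intro sum.cong arg_cong2[where f="(+)"]) auto
  have e: "?e (Bob b p q) B = ?e p (B \<inter> Collect b) + ?e q (B - Collect b)"
    unfolding sum.distrib[symmetric] sum.Int_Diff[OF \<open>finite B\<close>, of _ "Collect b"]
    by (intro sum.cong arg_cong2[where f="(+)"]) auto
  have "(2::real) ^ comm_complexity p + 2 ^ comm_complexity q \<le> 2 ^ comm_complexity (Bob b p q)"
    using two_power_add_le by simp
  then have "\<eta> * (?n (Bob b p q) B - 2 ^ comm_complexity (Bob b p q) * t)
      \<le> \<eta> * (?n (Bob b p q) B - (2 ^ comm_complexity p + 2 ^ comm_complexity q) * t)"
    using Bob.prems by (intro mult_left_mono diff_left_mono mult_right_mono) auto
  then show ?case using p q unfolding n e by (simp add: algebra_simps)
qed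

section \<open>Errors of a fixed answer on a dense rectangle\<close>

text \<open>This is \<open>collision_frequent\<close> for the map
  \<open>z \<mapsto> s \<oplus> z\<close>: if \<open>z\<close> occurs in \<open>X\<close> and
  \<open>s \<oplus> z\<close> in \<open>Y\<close>, then their XOR is \<open>s\<close>, so
  \<open>s\<close> is no solution.\<close>

lemma rectangle_error_ge:
  fixes n m :: nat
  defines "I \<equiv> {X. length X = m \<and> set X \<subseteq> bitstrings n}"
  assumes n: "n \<ge> 1" and s: "s \<in> bitstrings n" and AB: "A \<subseteq> I" "B \<subseteq> I"
    and large: "2 / 2 ^ m * (card I)\<^sup>2 < real (card A) * real (card B)"
  shows "1 / 2 ^ (4 * n) * (card A * card B)
    \<le> (\<Sum>X\<in>A. \<Sum>Y\<in>B. of_bool (\<exists>i<m. \<exists>j<m. s = X ! i \<oplus> Y ! j))"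
proof -
  have I: "I = {X. set X \<subseteq> bitstrings n \<and> length X = m}" by (auto simp: I_def)
  have fin: "finite I"
    unfolding I by (rule finite_lists_length_eq[OF finite_bitstrings])
  have cI: "real (card I) = (2 ^ n) ^ m"
    unfolding I card_lists_length_eq[OF finite_bitstrings] card_bitstrings by simp
  have cI0: "real (card I) > 0" unfolding cI by simp
  have finAB: "finite A" "finite B"
    using finite_subset[OF _ fin] AB by auto
  have le: "real (card A) \<le> card I" "real (card B) \<le> card I"
    using card_mono[OF fin] AB by auto
  \<comment> \<open>Density \<open>2 / 2 ^ m\<close> of one side is exactly the threshold of
    \<open>collision_frequent\<close>. Each side exceeds it because the other side has density at
    most 1.\<close>
  have eq: "2 / 2 ^ m * real (card I) = 2 * (card (bitstrings n) / 2) ^ m"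
    unfolding cI card_bitstrings by (simp add: power_divide)
  have "2 / 2 ^ m * real (card I) * card I < real (card A) * card I"
    using large mult_left_mono[OF le(2), of "real (card A)"] by (simp add: power2_eq_square)
  then have A: "2 * (card (bitstrings n) / 2) ^ m < real (card A)"
    unfolding eq using cI0 by (simp add: mult_less_cancel_right)
  have "2 / 2 ^ m * real (card I) * card I < real (card B) * card I"
    using large mult_right_mono[OF le(1), of "real (card B)"] by (simp add: power2_eq_square mult_ac)
  then have B: "2 * (card (bitstrings n) / 2) ^ m < real (card B)"
    unfolding eq using cI0 by (simp add: mult_less_cancel_right)
  have two: "2 \<le> card (bitstrings n)"
    using n power_increasing[of 1 n "2::nat"] by (simp add: card_bitstrings)
  have inj: "inj_on ((\<oplus>) s) (bitstrings n)"
    using s by (intro inj_on_inverseI[of _ "(\<oplus>) s"]) (simp add: bitstrings_def xor_string_cancel)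
  have closed: "(\<oplus>) s ` bitstrings n \<subseteq> bitstrings n"
    using s by (auto simp: bitstrings_def)
  have "real (card A) * real (card B) / card (bitstrings n) ^ 4
      \<le> card {(X, Y) \<in> A \<times> B. \<exists>z\<in>set X. s \<oplus> z \<in> set Y}"
    by (rule collision_frequent[OF finite_bitstrings two inj closed AB(1)[unfolded I] A AB(2)[unfolded I] B])
  also have "\<dots> \<le> card {(X, Y) \<in> A \<times> B. \<exists>i<m. \<exists>j<m. s = X ! i \<oplus> Y ! j}"
    unfolding of_nat_le_iff
  proof (rule card_mono)
    show "finite {(X, Y) \<in> A \<times> B. \<exists>i<m. \<exists>j<m. s = X ! i \<oplus> Y ! j}"
      by (rule finite_subset[of _ "A \<times> B"]) (use finAB in auto)
    have "\<exists>i<m. \<exists>j<m. s = X ! i \<oplus> Y ! j"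
      if XY: "X \<in> A" "Y \<in> B" and z: "z \<in> set X" "s \<oplus> z \<in> set Y" for X Y z
    proof -
      have len: "length X = m" "length Y = m" "length z = n" "length s = n"
        using AB XY z s by (auto simp: I_def bitstrings_def)
      obtain i where "i < m" "X ! i = z"
        using z(1) len(1) unfolding in_set_conv_nth by auto
      moreover obtain j where "j < m" "Y ! j = s \<oplus> z"
        using z(2) len(2) unfolding in_set_conv_nth by auto
      moreover have "s = z \<oplus> (s \<oplus> z)"
        using xor_string_cancel[of z s] len xor_string_commute[of s z] by simp
      ultimately show ?thesis by metis
    qed
    then show "{(X, Y) \<in> A \<times> B. \<exists>z\<in>set X. s \<oplus> z \<in> set Y}
        \<subseteq> {(X, Y) \<in> A \<times> B. \<exists>i<m. \<exists>j<m. s = X ! i \<oplus> Y ! j}"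
      by blast
  qed
  also have "real (card {(X, Y) \<in> A \<times> B. \<exists>i<m. \<exists>j<m. s = X ! i \<oplus> Y ! j})
      = (\<Sum>(X, Y)\<in>A \<times> B. of_bool (\<exists>i<m. \<exists>j<m. s = X ! i \<oplus> Y ! j))"
    using finAB unfolding case_prod_unfold by (subst sum_of_bool_eq) (auto intro: arg_cong[where f=card])
  also have "\<dots> = (\<Sum>X\<in>A. \<Sum>Y\<in>B. of_bool (\<exists>i<m. \<exists>j<m. s = X ! i \<oplus> Y ! j))"
    by (simp add: sum.cartesian_product)
  finally show ?thesis
    by (simp add: card_bitstrings power_mult[of _ n 4, symmetric] mult.commute[of n 4])
qed

section \<open>From conditional probabilities to counting coins\<close>

lemma prob_public_coins:
  "\<P>(r in public_coins P. Q r) = (\<Sum>r\<in>bitstrings (rand_length P). of_bool (Q r)) / 2 ^ rand_length P"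
  using finite_bitstrings bitstrings_nonempty
  by (simp add: measure_pmf_of_set card_bitstrings sum_of_bool_eq)

lemma comm_complexity_le:
  assumes "r \<in> bitstrings (rand_length P)"
  shows "rand_length P + comm_complexity (family P r) \<le> postBPP_complexity P"
  unfolding postBPP_complexity_def using assms finite_bitstrings
  by (intro add_left_mono Max_ge) auto

text \<open>Clears the denominators, so that the guarantee can be summed over all inputs. A positive
  number of answering coins is at least 1, which is where the probability \<open>2 ^ -k\<close> of
  an answer comes from.\<close>

lemma solves_with_errorD:
  assumes "solves_with_error P f \<epsilon>" "X \<in> alice_inputs f" "Y \<in> bob_inputs f"
  defines "R \<equiv> bitstrings (rand_length P)"
  shows "1 \<le> (\<Sum>r\<in>R. of_bool (run (family P r) X Y \<noteq> None) :: real)"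
    and "(\<Sum>r\<in>R. of_bool (\<exists>s. run (family P r) X Y = Some s \<and> \<not> is_solution f X Y s))
      \<le> \<epsilon> * (\<Sum>r\<in>R. of_bool (run (family P r) X Y \<noteq> None))"
proof -
  let ?none = "\<lambda>r. run (family P r) X Y \<noteq> None"
  let ?good = "\<lambda>r. \<exists>s. run (family P r) X Y = Some s \<and> s \<in> range_of f \<and> is_solution f X Y s"
  let ?bad = "\<lambda>r. \<exists>s. run (family P r) X Y = Some s \<and> \<not> is_solution f X Y s"
  let ?S = "\<lambda>Q. \<Sum>r\<in>R. of_bool (Q r) :: real"
  from assms have pos: "\<P>(r in public_coins P. ?none r) > 0"
    and cond: "1 - \<epsilon> \<le> \<P>(r in public_coins P. ?good r \<bar> ?none r)"
    by (auto simp: solves_with_error_def)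
  have S_pos: "?S ?none > 0"
    using pos unfolding prob_public_coins R_def by (simp add: zero_less_divide_iff)
  have "\<exists>r\<in>R. ?none r"
  proof (rule ccontr)
    assume "\<not> (\<exists>r\<in>R. ?none r)"
    then have "?S ?none = 0"
      by (intro sum.neutral) simp
    with S_pos show False by simp
  qed
  then obtain r where r: "r \<in> R" "?none r" by blast
  then show "1 \<le> ?S ?none"
    using member_le_sum[OF r(1), of "\<lambda>r. of_bool (?none r) :: real"] finite_bitstrings
    by (simp add: R_def)
  have "1 - \<epsilon> \<le> ?S (\<lambda>r. ?good r \<and> ?none r) / ?S ?none"
    using cond unfolding cond_prob_def prob_public_coins R_def by simp
  then have "(1 - \<epsilon>) * ?S ?none \<le> ?S (\<lambda>r. ?good r \<and> ?none r)"
    using S_pos by (simp add: pos_le_divide_eq)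
  \<comment> \<open>Good and bad coins are disjoint subsets of the answering ones.\<close>
  moreover have "?S (\<lambda>r. ?good r \<and> ?none r) + ?S ?bad \<le> ?S ?none"
    unfolding sum.distrib[symmetric] by (intro sum_mono) auto
  ultimately show "?S ?bad \<le> \<epsilon> * ?S ?none"
    by (simp add: algebra_simps)
qed

section \<open>The lower bound\<close>

text \<open>Double counting of wrong answers: summing over inputs first bounds them above by the
  error guarantee, summing over coins first bounds them below by the rectangle argument.\<close>

lemma XOR_Missing_String_complexity_ge:
  assumes n: "n \<ge> 2" and \<epsilon>: "\<epsilon> \<le> 1 / 2 ^ (5 * n)"
    and P: "solves_with_error P (XOR_Missing_String n m) \<epsilon>"
  shows "m < postBPP_complexity P + 2"
proof (rule ccontr)
  assume "\<not> m < postBPP_complexity P + 2"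
  then have K: "postBPP_complexity P + 2 \<le> m" by simp
  define I where "I = {X. length X = m \<and> set X \<subseteq> bitstrings n}"
  define R where "R = bitstrings (rand_length P)"
  define \<eta> t where "\<eta> = 1 / (2::real) ^ (4 * n)" and "t = 2 / 2 ^ m * (real (card I))\<^sup>2"
  have I: "I = {X. set X \<subseteq> bitstrings n \<and> length X = m}" by (auto simp: I_def)
  have fin: "finite I"
    unfolding I by (rule finite_lists_length_eq[OF finite_bitstrings])
  have cI: "real (card I) > 0"
    unfolding I card_lists_length_eq[OF finite_bitstrings] card_bitstrings by simp
  let ?f = "XOR_Missing_String n m"
  have inp: "alice_inputs ?f = I" "bob_inputs ?f = I"
    by (auto simp: XOR_Missing_String_def I_def)
  let ?n = "\<lambda>r X Y. of_bool (run (family P r) X Y \<noteq> None) :: real"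
  let ?e = "\<lambda>r X Y. of_bool (\<exists>s. run (family P r) X Y = Some s \<and> \<not> is_solution ?f X Y s) :: real"
  \<comment> \<open>\<open>T\<close> counts the triples of two inputs and a coin that yield an
    answer, and \<open>E\<close> those that yield a wrong one.\<close>
  define T where "T = (\<Sum>X\<in>I. \<Sum>Y\<in>I. \<Sum>r\<in>R. ?n r X Y)"
  define E where "E = (\<Sum>X\<in>I. \<Sum>Y\<in>I. \<Sum>r\<in>R. ?e r X Y)"
  have T: "T = (\<Sum>r\<in>R. \<Sum>X\<in>I. \<Sum>Y\<in>I. ?n r X Y)" "E = (\<Sum>r\<in>R. \<Sum>X\<in>I. \<Sum>Y\<in>I. ?e r X Y)"
    unfolding T_def E_def by (simp_all only: sum.swap[where A = I and B = R])
  have "(\<Sum>X\<in>I. \<Sum>Y\<in>I. 1) \<le> T"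
    unfolding T_def R_def using solves_with_errorD(1)[OF P] inp by (intro sum_mono) auto
  then have T_ge: "(real (card I))\<^sup>2 \<le> T" by (simp add: power2_eq_square)
  then have T_pos: "T > 0"
    using cI by (intro less_le_trans[OF _ T_ge] zero_less_power)
  have E_le: "E \<le> \<epsilon> * T"
    unfolding E_def T_def R_def sum_distrib_left[of _ _ I]
    using solves_with_errorD(2)[OF P] inp by (intro sum_mono) auto
  \<comment> \<open>Each coin may write off an equal share of \<open>T / 2\<close>. The 2 in
    \<open>K\<close> pays for the factor 2 in \<open>t\<close> and for the halving of
    \<open>T\<close>.\<close>
  have each: "\<eta> * ((\<Sum>X\<in>I. \<Sum>Y\<in>I. ?n r X Y) - T / 2 / card R) \<le> (\<Sum>X\<in>I. \<Sum>Y\<in>I. ?e r X Y)"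
    if r: "r \<in> R" for r
  proof -
    let ?c = "comm_complexity (family P r)"
    have "rand_length P + ?c + 2 \<le> m"
      using comm_complexity_le[of r P] r K by (simp add: R_def)
    then have "(2::real) ^ (rand_length P + ?c + 2) \<le> 2 ^ m"
      by (intro power_increasing) auto
    then have "2 ^ ?c * (2 / 2 ^ m) \<le> 1 / 2 / (2::real) ^ rand_length P"
      by (simp add: field_simps power_add)
    then have "2 ^ ?c * (2 / 2 ^ m) * (real (card I))\<^sup>2 \<le> 1 / 2 / 2 ^ rand_length P * T"
      using T_ge by (intro mult_mono) auto
    then have "2 ^ ?c * t \<le> T / 2 / card R"
      by (simp add: R_def card_bitstrings t_def mult.assoc)
    then have "\<eta> * ((\<Sum>X\<in>I. \<Sum>Y\<in>I. ?n r X Y) - T / 2 / card R)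
        \<le> \<eta> * ((\<Sum>X\<in>I. \<Sum>Y\<in>I. ?n r X Y) - 2 ^ ?c * t)"
      by (intro mult_left_mono diff_left_mono) (auto simp: \<eta>_def)
    also have "\<dots> \<le> (\<Sum>X\<in>I. \<Sum>Y\<in>I. ?e r X Y)"
    proof (rule protocol_error_ge[OF fin fin])
      show "outputs (family P r) \<subseteq> insert None (Some ` bitstrings n)"
        using P r by (auto simp: solves_with_error_def postBPP_protocol_for_def R_def
            XOR_Missing_String_def)
      fix s A B assume "s \<in> bitstrings n" "A \<subseteq> I" "B \<subseteq> I" "t < real (card A) * real (card B)"
      then show "\<eta> * (card A * card B) \<le> (\<Sum>X\<in>A. \<Sum>Y\<in>B. of_bool (\<not> is_solution ?f X Y s))"
        using rectangle_error_ge[of n s A m B] n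
        by (simp add: \<eta>_def t_def I_def XOR_Missing_String_def)
    qed (auto simp: \<eta>_def t_def)
    finally show ?thesis .
  qed
  have "real (card R) > 0"
    by (simp add: R_def card_bitstrings)
  then have "\<eta> * (T - T / 2) = (\<Sum>r\<in>R. \<eta> * ((\<Sum>X\<in>I. \<Sum>Y\<in>I. ?n r X Y) - T / 2 / card R))"
    by (simp add: T(1) sum_subtractf flip: sum_distrib_left)
  also have "\<dots> \<le> E"
    unfolding T(2) by (intro sum_mono each)
  also note E_le
  finally have "\<eta> / 2 * T \<le> \<epsilon> * T" by simp
  then have "\<eta> / 2 \<le> \<epsilon>"
    using T_pos by (simp add: mult_le_cancel_right)
  also note \<epsilon>
  \<comment> \<open>The exponents 5 and 4 leave a gap of \<open>2 ^ n\<close>, which exceeds the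
    lost factor 2 once \<open>n \<ge> 2\<close>.\<close>
  finally have "(2::real) ^ (5 * n) \<le> 2 * 2 ^ (4 * n)"
    by (simp add: \<eta>_def field_simps)
  moreover have "(2::real) ^ (5 * n) = 2 ^ n * 2 ^ (4 * n)"
    by (simp flip: power_add)
  ultimately have "(2::real) ^ n \<le> 2" by simp
  moreover have "(2::real) ^ 2 \<le> 2 ^ n"
    using n by (intro power_increasing) auto
  ultimately show False by simp
qed

theorem theorem1p4:
  "\<exists>c::real. c > 0 \<and>
     (\<forall>(n::nat) (m::nat) (\<epsilon>::real)
        (P :: (bool list list, bool list list, bool list) postBPP_protocol).
        n \<ge> 1 \<longrightarrow> 20 * n \<le> m \<longrightarrow> real m < 2 powr (real n / 2) \<longrightarrow>
        \<epsilon> \<le> 2 powr (- 5 * real n) \<longrightarrow>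
        solves_with_error P (XOR_Missing_String n m) \<epsilon> \<longrightarrow>
        real (postBPP_complexity P) \<ge> c * real m)"
proof (intro exI[of _ "1 / 2"] conjI allI impI)
  fix n m :: nat and \<epsilon> :: real
    and P :: "(bool list list, bool list list, bool list) postBPP_protocol"
  assume n: "n \<ge> 1" and m: "20 * n \<le> m" "real m < 2 powr (real n / 2)"
    and \<epsilon>: "\<epsilon> \<le> 2 powr (- 5 * real n)"
    and P: "solves_with_error P (XOR_Missing_String n m) \<epsilon>"
  \<comment> \<open>For \<open>n = 1\<close> the bounds on \<open>m\<close> contradict each other:
    20 is not below \<open>2 powr (1 / 2)\<close>.\<close>
  have "n \<noteq> 1"
  proof
    assume "n = 1"
    then have "2 powr (real n / 2) \<le> 2 powr 1"
      by (intro powr_mono) simp_all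
    with m \<open>n = 1\<close> show False by simp
  qed
  moreover have "2 powr (- 5 * real n) = 1 / 2 ^ (5 * n)"
    using powr_minus_divide[of 2 "real (5 * n)"] powr_realpow[of 2 "5 * n"] by simp
  ultimately have "m < postBPP_complexity P + 2"
    using XOR_Missing_String_complexity_ge[OF _ _ P] n \<epsilon> by simp
  \<comment> \<open>The complexity is at least \<open>m - 1\<close>, and \<open>m \<ge> 20\<close>
    makes this at least \<open>m / 2\<close>.\<close>
  then show "1 / 2 * real m \<le> real (postBPP_complexity P)"
    using n m(1) by simp
qed simp

end
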